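(* If $G$ is a 2-generated profinite group, then $V(G)$ is a closed subset of $G$.
   Context: For a profinite group $G$, generation is meant topologically: $\langle X\rangle = G$ means that the abstract subgroup generated by $X$ is dense in $G$. $G$ is 2-generated if $G=\langle a,b\rangle$ for some $a,b\in G$. The generating graph $\Gamma(G)$ has vertex set $G$, with two elements $x,y$ adjacent if and only if $\langle x,y\rangle=G$. $V(G)$ is the set of non-isolated vertices of $\Gamma(G)$, i.e. the set of $x\in G$ for which there exists $y\in G$ with $\langle x,y\rangle=G$. *)

theory Defs
  imports "HOL-Analysis.Analysis" "HOL-Algebra.Generated_Groups"
begin

no_notation eq_closure_of (\<open>closure'_of\<index>\<close>)

locale topological_group = group G for G (structure) +
  fixes T :: "'a topology"
  assumes topspace_eq: "topspace T = carrier G"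
    and continuous_mult: "continuous_map (prod_topology T T) T (\<lambda>(x, y). x \<otimes> y)"
    and continuous_inv: "continuous_map T T (\<lambda>x. inv x)"

definition totally_disconnected_space :: "'a topology \<Rightarrow> bool" where
  "totally_disconnected_space T \<longleftrightarrow>
     (\<forall>C. connectedin T C \<longrightarrow> (\<forall>x\<in>C. \<forall>y\<in>C. x = y))"

locale profinite_group = topological_group +
  assumes compact: "compact_space T"
    and Hausdorff: "Hausdorff_space T"
    and totally_disconnected: "totally_disconnected_space T"

definition topologically_generates ::
    "('a, 'b) monoid_scheme \<Rightarrow> 'a topology \<Rightarrow> 'a set \<Rightarrow> bool" where
  "topologically_generates G T S \<longleftrightarrow>
     S \<subseteq> carrier G \<and> T closure_of (generate G S) = carrier G"

definition two_generated :: "('a, 'b) monoid_scheme \<Rightarrow> 'a topology \<Rightarrow> bool" where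
  "two_generated G T \<longleftrightarrow>
     (\<exists>a\<in>carrier G. \<exists>b\<in>carrier G. topologically_generates G T {a, b})"

text \<open>Adjacency in the generating graph, whose vertex set is \<open>carrier G\<close>. The case
  \<open>x = y\<close> is not excluded; it affects the set of non-isolated vertices below only when
  \<open>G\<close> is trivial, since an \<open>x\<close> generating \<open>G\<close> alone is also adjacent to \<open>\<one>\<close>.\<close>

definition generating_adj ::
    "('a, 'b) monoid_scheme \<Rightarrow> 'a topology \<Rightarrow> 'a \<Rightarrow> 'a \<Rightarrow> bool" where
  "generating_adj G T x y \<longleftrightarrow>
     x \<in> carrier G \<and> y \<in> carrier G \<and> topologically_generates G T {x, y}"

definition nonisolated_vertices ::
    "('a, 'b) monoid_scheme \<Rightarrow> 'a topology \<Rightarrow> 'a set" where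
  "nonisolated_vertices G T = {x \<in> carrier G. \<exists>y\<in>carrier G. generating_adj G T x y}"

end

(* The set of generating pairs is closed in G \<times> G, and V(G) is its image under the first
   projection, which is a closed map because G is compact. Closedness of the set of pairs: if
   H = \<langle>x, y\<rangle> is not dense, then H lies in a clopen subgroup S missing some z, and no pair in the
   neighbourhood S \<times> S of (x, y) generates. To find S, take a clopen U containing H but not z,
   replace it by the clopen set of all u with H u \<subseteq> U, which is invariant under left translation by
   H, and let S be the stabilizer of that set. *)

theory Submission
  imports Defs
begin

text \<open>A form of the tube lemma: the complement is the projection to \<open>X\<close> of the
  part of \<open>X\<close> times \<open>A\<close> outside \<open>W\<close>, and projecting along the
  compact factor \<open>A\<close> is a closed map.\<close>

lemma openin_Ball_compactin:
  assumes "compactin Y A" "openin (prod_topology X Y) W"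
  shows "openin X {x \<in> topspace X. \<forall>y\<in>A. (x, y) \<in> W}"
proof -
  let ?Z = "prod_topology X (subtopology Y A)"
  have A: "A \<subseteq> topspace Y"
    using assms(1) by (rule compactin_subset_topspace)
  have Z: "?Z = subtopology (prod_topology X Y) (UNIV \<times> A)"
    by (simp add: subtopology_Times)
  have "openin ?Z ((UNIV \<times> A) \<inter> W)"
    unfolding Z using assms(2) by (rule openin_subtopology_Int2)
  then have "closedin ?Z (topspace ?Z - (UNIV \<times> A) \<inter> W)"
    by blast
  moreover have "closed_map ?Z X fst"
    using assms(1) by (intro closed_map_fst) (simp add: compactin_subspace)
  ultimately have "closedin X (fst ` (topspace ?Z - (UNIV \<times> A) \<inter> W))"
    by (simp add: closed_map_def)
  then have "openin X (topspace X - fst ` (topspace ?Z - (UNIV \<times> A) \<inter> W))"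
    by blast
  also have "topspace X - fst ` (topspace ?Z - (UNIV \<times> A) \<inter> W)
      = {x \<in> topspace X. \<forall>y\<in>A. (x, y) \<in> W}"
    using A by force
  finally show ?thesis .
qed

text \<open>The set is an intersection of slices of \<open>W\<close>, each closed as a preimage
  under \<open>x\<close> to \<open>(x, y)\<close>.\<close>

lemma closedin_Ball:
  assumes "A \<subseteq> topspace Y" "closedin (prod_topology X Y) W"
  shows "closedin X {x \<in> topspace X. \<forall>y\<in>A. (x, y) \<in> W}"
proof -
  have "closedin X {x \<in> topspace X. (x, y) \<in> W}" if "y \<in> A" for y
  proof (rule closedin_continuous_map_preimage[OF _ assms(2)])
    show "continuous_map X (prod_topology X Y) (\<lambda>x. (x, y))"
      using that assms(1) by (auto intro!: continuous_map_pairedI)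
  qed
  \<comment> \<open>For empty \<open>A\<close> the indexed intersection is \<open>UNIV\<close>; the
    factor \<open>topspace X\<close> keeps it inside the space.\<close>
  then have "closedin X (topspace X \<inter> (\<Inter>y\<in>A. {x \<in> topspace X. (x, y) \<in> W}))"
    by (cases "A = {}") (auto intro!: closedin_Int closedin_INT)
  also have "topspace X \<inter> (\<Inter>y\<in>A. {x \<in> topspace X. (x, y) \<in> W})
      = {x \<in> topspace X. \<forall>y\<in>A. (x, y) \<in> W}"
    by auto
  finally show ?thesis .
qed

text \<open>In a compact Hausdorff space quasi-components are connected components, here single
  points. So a clopen set separates \<open>z\<close> from each point of \<open>K\<close>, and
  compactness of \<open>K\<close> gives one for all of \<open>K\<close>.\<close>

lemma separated_between_closedin_point:
  assumes "compact_space X" "Hausdorff_space X" "totally_disconnected_space X"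
    and "closedin X K" "z \<in> topspace X" "z \<notin> K"
  shows "separated_between X K {z}"
proof -
  have "\<not> quasi_component_of X x z" if "x \<in> K" for x
  proof
    assume "quasi_component_of X x z"
    then have "connected_component_of X x z"
      using assms(1,2) quasi_eq_connected_component_of by metis
    then obtain C where "connectedin X C" "x \<in> C" "z \<in> C"
      by (auto simp: connected_component_of_def)
    then have "x = z"
      using assms(3) by (auto simp: totally_disconnected_space_def)
    with that assms(6) show False
      by simp
  qed
  then have "separated_between X {x} {z}" if "x \<in> K" for x
    using that assms(4,5) closedin_subset by (fastforce simp: separated_between_singletons)
  moreover have "compactin X K"
    using assms(1,4) by (rule closedin_compact_space)
  ultimately show ?thesis
    using assms(5) by (simp add: separated_between_pointwise_left)
qed

text \<open>The stabilizer of the part of \<open>U\<close> in the carrier under left translation.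
  The equivalence encodes both inclusions of a set equality, which gives closure under
  inverses.\<close>

definition translation_stabilizer :: "('a, 'b) monoid_scheme \<Rightarrow> 'a set \<Rightarrow> 'a set" where
  "translation_stabilizer G U =
     {g \<in> carrier G. \<forall>u\<in>carrier G. g \<otimes>\<^bsub>G\<^esub> u \<in> U \<longleftrightarrow> u \<in> U}"

lemma (in group) subgroup_translation_stabilizer: "subgroup (translation_stabilizer G U) G"
proof
  fix g assume g: "g \<in> translation_stabilizer G U"
  then have gc: "g \<in> carrier G"
    by (simp add: translation_stabilizer_def)
  have "inv g \<otimes> u \<in> U \<longleftrightarrow> u \<in> U" if u: "u \<in> carrier G" for u
  proof -
    have "g \<otimes> (inv g \<otimes> u) \<in> U \<longleftrightarrow> inv g \<otimes> u \<in> U"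
      using g gc u by (simp add: translation_stabilizer_def)
    then show ?thesis
      using gc u by (simp flip: m_assoc)
  qed
  with gc show "inv g \<in> translation_stabilizer G U"
    by (simp add: translation_stabilizer_def)
qed (auto simp: translation_stabilizer_def m_assoc)

context topological_group
begin

lemma clopen_translation_stabilizer:
  assumes "compact_space T" "openin T U" "closedin T U"
  shows "openin T (translation_stabilizer G U)" "closedin T (translation_stabilizer G U)"
proof -
  let ?P = "prod_topology T T"
  define A where "A = {p \<in> topspace ?P. (case p of (g, u) \<Rightarrow> g \<otimes> u) \<in> U}"
  define B where "B = {p \<in> topspace ?P. snd p \<in> U}"
  \<comment> \<open>The pairs on which membership in \<open>A\<close> and in \<open>B\<close> agree:
    the equivalence that defines the stabilizer becomes a clopen condition, to be quantified over
    the compact group.\<close>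
  define W where "W = (A \<inter> B) \<union> (topspace ?P - (A \<union> B))"
  have "openin ?P A" "closedin ?P A"
    unfolding A_def using assms openin_continuous_map_preimage[OF continuous_mult]
      closedin_continuous_map_preimage[OF continuous_mult] by blast+
  moreover have "openin ?P B" "closedin ?P B"
    unfolding B_def using assms openin_continuous_map_preimage[OF continuous_map_snd]
      closedin_continuous_map_preimage[OF continuous_map_snd] by blast+
  ultimately have W: "openin ?P W" "closedin ?P W"
    unfolding W_def by blast+
  have eq: "translation_stabilizer G U = {g \<in> topspace T. \<forall>u\<in>topspace T. (g, u) \<in> W}"
    by (auto simp: translation_stabilizer_def topspace_eq W_def A_def B_def)
  have "compactin T (topspace T)"
    using assms(1) by (simp add: compact_space_def)
  then show "openin T (translation_stabilizer G U)"
    unfolding eq using W(1) by (rule openin_Ball_compactin)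
  show "closedin T (translation_stabilizer G U)"
    unfolding eq using subset_refl W(2) by (rule closedin_Ball)
qed

end

lemma (in profinite_group) clopen_subgroup_separating:
  assumes H: "subgroup H G" and z: "z \<in> carrier G" "z \<notin> T closure_of H"
  obtains S where "subgroup S G" "openin T S" "closedin T S" "H \<subseteq> S" "z \<notin> S"
proof -
  let ?K = "T closure_of H"
  have Hc: "H \<subseteq> carrier G"
    using H by (rule subgroup.subset)
  have HK: "H \<subseteq> ?K" and Kc: "?K \<subseteq> carrier G"
    using Hc closure_of_subset closure_of_subset_topspace topspace_eq by metis+
  have "separated_between T ?K {z}"
    using compact Hausdorff totally_disconnected z
    by (intro separated_between_closedin_point) (simp_all add: topspace_eq)
  then obtain U where U: "openin T U" "closedin T U" "?K \<subseteq> U" "z \<notin> U"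
    by (auto simp: separated_between)
  let ?P = "prod_topology T T"
  \<comment> \<open>The factors are swapped so that the quantified variable \<open>h\<close> is the
    second coordinate, as in the two lemmas on bounded quantification.\<close>
  define W where "W = {p \<in> topspace ?P. (case p of (u, h) \<Rightarrow> h \<otimes> u) \<in> U}"
  have swap: "continuous_map ?P T (\<lambda>(u, h). h \<otimes> u)"
    using continuous_map_compose[OF continuous_map_pairedI[OF continuous_map_snd continuous_map_fst]
        continuous_mult]
    by (simp add: o_def case_prod_unfold)
  have W: "openin ?P W" "closedin ?P W"
    unfolding W_def using U openin_continuous_map_preimage[OF swap]
      closedin_continuous_map_preimage[OF swap] by blast+
  \<comment> \<open>This is the largest subset of \<open>U\<close> that is invariant under left
    translation by \<open>H\<close>.\<close>
  define U' where "U' = {u \<in> carrier G. \<forall>h\<in>H. h \<otimes> u \<in> U}"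
  have U'_H: "U' = {u \<in> topspace T. \<forall>h\<in>H. (u, h) \<in> W}"
    using Hc by (auto simp: U'_def W_def topspace_eq)
  have "closedin T U'"
    unfolding U'_H using Hc W(2) by (intro closedin_Ball) (simp_all add: topspace_eq)
  \<comment> \<open>Openness of \<open>U'\<close> requires quantifying over a compact set, but
    \<open>H\<close> need not be closed. For fixed \<open>u\<close> the condition on
    \<open>h\<close> is closed, so it passes from \<open>H\<close> to its closure, which is
    compact.\<close>
  have "h \<otimes> u \<in> U" if "u \<in> U'" "h \<in> ?K" for u h
  proof -
    have u: "u \<in> carrier G"
      using that(1) by (simp add: U'_def)
    then have "continuous_map T ?P (\<lambda>h. (h, u))"
      by (auto intro!: continuous_map_pairedI simp: topspace_eq)
    then have "continuous_map T T (\<lambda>h. h \<otimes> u)"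
      using continuous_map_compose[OF _ continuous_mult] by (fastforce simp: o_def)
    then have "closedin T {h \<in> topspace T. h \<otimes> u \<in> U}"
      using U(2) by (rule closedin_continuous_map_preimage)
    moreover have "H \<subseteq> {h \<in> topspace T. h \<otimes> u \<in> U}"
      using that(1) Hc by (auto simp: U'_def topspace_eq)
    ultimately show ?thesis
      using that(2) closure_of_minimal by blast
  qed
  then have U'_K: "U' = {u \<in> topspace T. \<forall>h\<in>?K. (u, h) \<in> W}"
    using HK Kc by (auto simp: U'_def W_def topspace_eq)
  have "openin T U'"
    unfolding U'_K using compact W(1)
    by (intro openin_Ball_compactin) (simp_all add: closedin_compact_space)
  show thesis
  proof
    show "subgroup (translation_stabilizer G U') G"
      by (rule subgroup_translation_stabilizer)
    show "openin T (translation_stabilizer G U')" "closedin T (translation_stabilizer G U')"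
      using compact \<open>openin T U'\<close> \<open>closedin T U'\<close> by (rule clopen_translation_stabilizer)+
    show "H \<subseteq> translation_stabilizer G U'"
    proof
      fix h assume h: "h \<in> H"
      have "h \<otimes> u \<in> U' \<longleftrightarrow> u \<in> U'" if u: "u \<in> carrier G" for u
      proof -
        \<comment> \<open>Invariance of \<open>U'\<close> holds because right multiplication by
          \<open>h\<close> permutes \<open>H\<close>; the forward direction below substitutes
          \<open>k \<otimes> inv h\<close> for \<open>k\<close>.\<close>
        have "(\<forall>k\<in>H. k \<otimes> (h \<otimes> u) \<in> U) \<longleftrightarrow> (\<forall>k\<in>H. (k \<otimes> h) \<otimes> u \<in> U)"
          using h u Hc by (metis m_assoc subsetD)
        also have "\<dots> \<longleftrightarrow> (\<forall>k\<in>H. k \<otimes> u \<in> U)"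
        proof
          assume *: "\<forall>k\<in>H. (k \<otimes> h) \<otimes> u \<in> U"
          show "\<forall>k\<in>H. k \<otimes> u \<in> U"
          proof
            fix k assume k: "k \<in> H"
            then have "k \<otimes> inv h \<in> H"
              using H h by (simp add: subgroup.m_closed subgroup.m_inv_closed)
            with * have "k \<otimes> inv h \<otimes> h \<otimes> u \<in> U"
              by blast
            moreover have "k \<otimes> inv h \<otimes> h = k"
              using h k Hc by (simp add: m_assoc subset_iff)
            ultimately show "k \<otimes> u \<in> U"
              by simp
          qed
        qed (use H h in \<open>simp add: subgroup.m_closed\<close>)
        finally show ?thesis
          using h u Hc by (auto simp: U'_def)
      qed
      with h Hc show "h \<in> translation_stabilizer G U'"
        by (auto simp: translation_stabilizer_def)
    qed
    \<comment> \<open>Left translation by \<open>z\<close> moves \<open>\<one>\<close>, which lies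
      in \<open>U'\<close>, to \<open>z\<close>, which does not; hence \<open>z\<close> is not in
      the stabilizer.\<close>
    have "\<one> \<in> U'"
      using HK U(3) Hc by (simp add: U'_def subset_iff)
    moreover have "z \<notin> U'"
    proof
      assume "z \<in> U'"
      then have "\<one> \<otimes> z \<in> U"
        using subgroup.one_closed[OF H] unfolding U'_def by blast
      with U(4) z(1) show False
        by simp
    qed
    ultimately show "z \<notin> translation_stabilizer G U'"
      using one_closed r_one[OF z(1)] unfolding translation_stabilizer_def by fastforce
  qed
qed

lemma (in profinite_group) closedin_generating_pairs:
  "closedin (prod_topology T T) {(x, y). generating_adj G T x y}"
proof -
  let ?P = "prod_topology T T" and ?E = "{(x, y). generating_adj G T x y}"
  have "\<exists>N. openin ?P N \<and> p \<in> N \<and> N \<subseteq> topspace ?P - ?E" if "p \<in> topspace ?P - ?E" for p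
  proof -
    obtain x y where p: "p = (x, y)"
      by fastforce
    with that have xy: "{x, y} \<subseteq> carrier G" and "T closure_of (generate G {x, y}) \<noteq> carrier G"
      by (auto simp: topspace_eq generating_adj_def topologically_generates_def)
    then obtain z where z: "z \<in> carrier G" "z \<notin> T closure_of (generate G {x, y})"
      using closure_of_subset_topspace[of T] topspace_eq by blast
    obtain S where S: "subgroup S G" "openin T S" "closedin T S" "generate G {x, y} \<subseteq> S" "z \<notin> S"
      using clopen_subgroup_separating[OF generate_is_subgroup[OF xy] z] .
    \<comment> \<open>Both halves of clopen count: a closed subgroup containing \<open>a\<close> and
      \<open>b\<close> contains the closure of what they generate, so \<open>z\<close> is missed;
      openness makes \<open>S \<times> S\<close> a neighbourhood.\<close>
    have "\<not> generating_adj G T a b" if "a \<in> S" "b \<in> S" for a b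
    proof -
      have "generate G {a, b} \<subseteq> S"
        using that S(1) by (intro generate_subgroup_incl) auto
      then have "T closure_of (generate G {a, b}) \<subseteq> S"
        using S(3) by (rule closure_of_minimal)
      with z(1) S(5) show ?thesis
        by (auto simp: generating_adj_def topologically_generates_def)
    qed
    moreover have "(x, y) \<in> S \<times> S"
      using S(4) generate.incl[of _ "{x, y}" G] by blast
    moreover have "openin ?P (S \<times> S)"
      using S(2) by (simp add: openin_prod_Times_iff)
    ultimately show ?thesis
      using p openin_subset[OF \<open>openin ?P (S \<times> S)\<close>] by (intro exI[of _ "S \<times> S"]) auto
  qed
  then have "openin ?P (topspace ?P - ?E)"
    by (subst openin_subopen) blast
  moreover have "?E \<subseteq> topspace ?P"
    by (auto simp: topspace_eq generating_adj_def)
  ultimately show ?thesis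
    by (simp add: closedin_def)
qed

theorem proposition6:
  fixes G :: "('a, 'b) monoid_scheme" and T :: "'a topology"
  assumes "profinite_group G T"
    and "two_generated G T"
  shows "closedin T (nonisolated_vertices G T)"
proof -
  interpret profinite_group G T
    by (rule assms(1))
  \<comment> \<open>Adjacency already places both vertices in the carrier, so the projection needs
    no further restriction.\<close>
  have "nonisolated_vertices G T = fst ` {(x, y). generating_adj G T x y}"
  proof (intro subset_antisym subsetI)
    fix x assume "x \<in> nonisolated_vertices G T"
    then obtain y where "generating_adj G T x y"
      unfolding nonisolated_vertices_def by blast
    then show "x \<in> fst ` {(x, y). generating_adj G T x y}"
      by (intro image_eqI[of _ _ "(x, y)"]) simp_all
  next
    fix x assume "x \<in> fst ` {(x, y). generating_adj G T x y}"
    then obtain y where "generating_adj G T x y"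
      by fastforce
    then show "x \<in> nonisolated_vertices G T"
      unfolding nonisolated_vertices_def generating_adj_def by blast
  qed
  then show ?thesis
    using closed_map_fst[OF compact, of T] closedin_generating_pairs by (simp add: closed_map_def)
qed

end
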